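(* Let $(A,\mu_{k,[r]})$ be a $\mathrm{Dend}_\infty$-algebra. Then $(A,\mu_k)$ is an $A_\infty$-algebra, where $$\mu_k:=\mu_{k,[1]}+\mu_{k,[2]}+\cdots+\mu_{k,[k]},\qquad 1\le k<\infty.$$
   Context: $\mathbb{K}$ is a field of characteristic $0$. $C_n=\{[1],\ldots,[n]\}$ is a set of $n$ symbols, $\mathbb{K}[C_n]$ the vector space with basis $C_n$. For $1\le \lambda\le j$, $i\ge 1$: $R_0^{j,i,\lambda}:C_{i+j-1}\to C_j$ sends $[r]$ to $[r]$ if $r\le\lambda-1$, to $[\lambda]$ if $\lambda\le r\le\lambda+i-1$, to $[r-i+1]$ if $r\ge\lambda+i$; $R^{j,i,\lambda}:C_{i+j-1}\to\mathbb{K}[C_i]$ sends $[r]$ to $[r-\lambda+1]$ if $\lambda\le r\le\lambda+i-1$ and to $[1]+\cdots+[i]$ otherwise. The notation $\mu_{k,x}$ is extended linearly to $x\in\mathbb{K}[C_k]$. A $\mathrm{Dend}_\infty$-algebra is a graded vector space $A=\oplus A_i$ with multilinear maps $\mu_{k,[r]}:A^{\otimes k}\to A$ ($[r]\in C_k$, $k\ge1$) of degree $k-2$ such that for all $n\ge1$, $[r]\in C_n$ and homogeneous $a_1,\ldots,a_n\in A$, $$\sum_{i+j=n+1}\sum_{\lambda=1}^j(-1)^{\lambda(i+1)+i(|a_1|+\cdots+|a_{\lambda-1}|)}\mu_{j,R_0^{j,i,\lambda}[r]}\big(a_1,\ldots,a_{\lambda-1},\mu_{i,R^{j,i,\lambda}[r]}(a_\lambda,\ldots,a_{\lambda+i-1}),a_{\lambda+i},\ldots,a_n\big)=0.$$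 An $A_\infty$-algebra is a graded vector space $A$ with multilinear maps $\mu_k:A^{\otimes k}\to A$ ($k\ge1$) of degree $k-2$ such that for all $n\ge1$ and homogeneous $a_1,\ldots,a_n\in A$, $$\sum_{i+j=n+1}\sum_{\lambda=1}^j(-1)^{\lambda(i+1)+i(|a_1|+\cdots+|a_{\lambda-1}|)}\mu_j\big(a_1,\ldots,a_{\lambda-1},\mu_i(a_\lambda,\ldots,a_{\lambda+i-1}),a_{\lambda+i},\ldots,a_n\big)=0.$$ *)

theory Defs
  imports Complex_Main "HOL-Library.Poly_Mapping"
begin

text \<open>The symbol \<open>[r]\<close> is encoded as the natural number \<open>r\<close> (counting from 1), and an
  element of \<open>K[C_n]\<close> as a finitely supported function \<open>nat \<Rightarrow>\<^sub>0 'k\<close> with keys in \<open>C n\<close>.\<close>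

definition C :: "nat \<Rightarrow> nat set"
  where "C n = {1..n}"

definition R0 :: "nat \<Rightarrow> nat \<Rightarrow> nat \<Rightarrow> nat \<Rightarrow> nat"
  where "R0 j i l r = (if r \<le> l - 1 then r else if r \<le> l + i - 1 then l else r - i + 1)"

text \<open>The parameter \<open>j\<close> only determines the domain \<open>C (i + j - 1)\<close>.\<close>

definition R :: "nat \<Rightarrow> nat \<Rightarrow> nat \<Rightarrow> nat \<Rightarrow> (nat \<Rightarrow>\<^sub>0 'k::field_char_0)"
  where "R j i l r =
    (if l \<le> r \<and> r \<le> l + i - 1 then Poly_Mapping.single (r - l + 1) 1
     else (\<Sum>s\<in>C i. Poly_Mapping.single s 1))"

text \<open>A tensor \<open>a_1 \<otimes> \<dots> \<otimes> a_k\<close> is represented by the list of its factors, so a multilinear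
  map with \<open>k\<close> arguments is a function on lists, of which only the values on lists of length \<open>k\<close>
  matter. Lists are indexed from 0: \<open>a_p\<close> is \<open>as ! (p - 1)\<close>.\<close>

locale graded_vector_space = vector_space scale
  for scale :: "'k::field_char_0 \<Rightarrow> 'a::ab_group_add \<Rightarrow> 'a" (infixr \<open>*s\<close> 75) +
  fixes A :: "int \<Rightarrow> 'a set"
  assumes subspace_component: "subspace (A d)"
    and direct_sum: "\<exists>!f. finite {d. f d \<noteq> 0} \<and> (\<forall>d. f d \<in> A d) \<and> x = (\<Sum>d | f d \<noteq> 0. f d)"
begin

definition multilinear :: "nat \<Rightarrow> ('a list \<Rightarrow> 'a) \<Rightarrow> bool"
  where "multilinear k f \<longleftrightarrow>
    (\<forall>as p. length as = k \<and> p < k \<longrightarrow> Vector_Spaces.linear scale scale (\<lambda>x. f (as[p := x])))"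

text \<open>The list \<open>as\<close> consists of homogeneous elements of degrees \<open>ds\<close>. The degrees are
  carried separately because the zero vector is homogeneous of every degree.\<close>

definition homogeneous :: "int list \<Rightarrow> 'a list \<Rightarrow> bool"
  where "homogeneous ds as \<longleftrightarrow> list_all2 (\<lambda>d a. a \<in> A d) ds as"

definition has_degree :: "nat \<Rightarrow> ('a list \<Rightarrow> 'a) \<Rightarrow> int \<Rightarrow> bool"
  where "has_degree k f e \<longleftrightarrow>
    (\<forall>ds as. length as = k \<and> homogeneous ds as \<longrightarrow> f as \<in> A (sum_list ds + e))"

text \<open>\<open>f (a_1, \<dots>, a_(l-1), g (a_l, \<dots>, a_(l+i-1)), a_(l+i), \<dots>, a_n)\<close>\<close>

definition insert_op :: "nat \<Rightarrow> nat \<Rightarrow> ('a list \<Rightarrow> 'a) \<Rightarrow> ('a list \<Rightarrow> 'a) \<Rightarrow> 'a list \<Rightarrow> 'a"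
  where "insert_op i l f g as =
    f (take (l - 1) as @ [g (take i (drop (l - 1) as))] @ drop (l + i - 1) as)"

text \<open>The degrees are integers, so the exponent may be negative, hence \<open>powi\<close>.\<close>

definition sign :: "nat \<Rightarrow> nat \<Rightarrow> int list \<Rightarrow> 'k"
  where "sign i l ds = (-1) powi (int (l * (i + 1)) + int i * sum_list (take (l - 1) ds))"

definition lin_ext :: "(nat \<Rightarrow> 'a list \<Rightarrow> 'a) \<Rightarrow> (nat \<Rightarrow>\<^sub>0 'k) \<Rightarrow> 'a list \<Rightarrow> 'a"
  where "lin_ext m x as = (\<Sum>s\<in>Poly_Mapping.keys x. Poly_Mapping.lookup x s *s m s as)"

end

locale Dend_inf_algebra = graded_vector_space scale A
  for scale :: "'k::field_char_0 \<Rightarrow> 'a::ab_group_add \<Rightarrow> 'a" (infixr \<open>*s\<close> 75)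
    and A :: "int \<Rightarrow> 'a set" +
  fixes \<mu> :: "nat \<Rightarrow> nat \<Rightarrow> 'a list \<Rightarrow> 'a"
  assumes multilinear: "\<lbrakk>1 \<le> k; r \<in> C k\<rbrakk> \<Longrightarrow> multilinear k (\<mu> k r)"
    and degree: "\<lbrakk>1 \<le> k; r \<in> C k\<rbrakk> \<Longrightarrow> has_degree k (\<mu> k r) (int k - 2)"
    and dend_identity:
      "\<lbrakk>1 \<le> n; r \<in> C n; length as = n; homogeneous ds as\<rbrakk> \<Longrightarrow>
        (\<Sum>(i, j)\<in>{(i, j). 1 \<le> i \<and> 1 \<le> j \<and> i + j = n + 1}. \<Sum>l = 1..j.
          sign i l ds *s
            insert_op i l (\<mu> j (R0 j i l r)) (lin_ext (\<mu> i) (R j i l r)) as) = 0"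

locale A_inf_algebra = graded_vector_space scale A
  for scale :: "'k::field_char_0 \<Rightarrow> 'a::ab_group_add \<Rightarrow> 'a" (infixr \<open>*s\<close> 75)
    and A :: "int \<Rightarrow> 'a set" +
  fixes \<mu> :: "nat \<Rightarrow> 'a list \<Rightarrow> 'a"
  assumes multilinear: "1 \<le> k \<Longrightarrow> multilinear k (\<mu> k)"
    and degree: "1 \<le> k \<Longrightarrow> has_degree k (\<mu> k) (int k - 2)"
    and stasheff_identity:
      "\<lbrakk>1 \<le> n; length as = n; homogeneous ds as\<rbrakk> \<Longrightarrow>
        (\<Sum>(i, j)\<in>{(i, j). 1 \<le> i \<and> 1 \<le> j \<and> i + j = n + 1}. \<Sum>l = 1..j.
          sign i l ds *s insert_op i l (\<mu> j) (\<mu> i) as) = 0"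

end

theory Submission imports Defs begin

text \<open>The Stasheff identity for the totals \<open>\<Sum>r. \<mu> k r\<close> is the sum of the \<open>Dend\<^sub>\<infinity>\<close> identities over
  all \<open>r \<in> C n\<close>. Since the signs do not depend on \<open>r\<close>, this can be checked separately for each
  choice of \<open>i\<close>, \<open>j\<close> and the position \<open>l\<close>. Fix these, and let \<open>r\<close> run through \<open>C (i + j - 1)\<close>.
  If \<open>r\<close> lies outside the block \<open>{l..l + i - 1}\<close>, the inner operation is already the total of
  the \<open>\<mu> i s\<close>, and the outer label \<open>R0 j i l r\<close> takes every value in \<open>C j\<close> other than \<open>l\<close> exactly
  once. If \<open>r\<close> lies in the block, the outer label is \<open>l\<close> and the inner label takes every value
  in \<open>C i\<close> exactly once, so by linearity of \<open>\<mu> j l\<close> in the slot \<open>l\<close> these terms add up to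
  \<open>\<mu> j l\<close> applied to the inner total. Together the terms give the composite of the two totals
  (\<open>sum_insert_op_R0_R\<close>).\<close>

context graded_vector_space
begin

lemma lin_ext_single: "lin_ext m (Poly_Mapping.single s 1) as = m s as"
  by (simp add: lin_ext_def)

lemma lin_ext_sum_single:
  assumes "finite S"
  shows "lin_ext m (\<Sum>s\<in>S. Poly_Mapping.single s 1) as = (\<Sum>s\<in>S. m s as)"
proof -
  have lookup: "Poly_Mapping.lookup (\<Sum>s\<in>S. Poly_Mapping.single s (1::'k)) t
      = (if t \<in> S then 1 else 0)" for t
    using assms by (simp add: lookup_sum lookup_single when_def)
  then have "Poly_Mapping.keys (\<Sum>s\<in>S. Poly_Mapping.single s (1::'k)) = S"
    by (auto simp: in_keys_iff split: if_splits)
  then show ?thesis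
    by (simp add: lin_ext_def lookup)
qed

lemma multilinear_linear_slot:
  assumes "multilinear k f" "length bs + length cs + 1 = k"
  shows "Vector_Spaces.linear scale scale (\<lambda>x. f (bs @ [x] @ cs))"
proof -
  have "Vector_Spaces.linear scale scale (\<lambda>x. f ((bs @ [0] @ cs)[length bs := x]))"
    using assms(2) by (intro assms(1)[unfolded multilinear_def, rule_format]) simp
  then show ?thesis
    by (simp add: list_update_append)
qed

lemma multilinear_insert_op_sum:
  assumes "multilinear j f" "1 \<le> l" "l \<le> j" "length as = i + j - 1" "1 \<le> i"
  shows "insert_op i l f (\<lambda>bs. \<Sum>s\<in>S. g s bs) as = (\<Sum>s\<in>S. insert_op i l f (g s) as)"
proof -
  interpret slot: Vector_Spaces.linear scale scale
    "\<lambda>x. f (take (l - 1) as @ [x] @ drop (l + i - 1) as)"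
    using assms by (intro multilinear_linear_slot[of j]) auto
  show ?thesis
    by (simp only: insert_op_def slot.sum)
qed

lemma multilinear_sum:
  assumes "\<And>s. s \<in> S \<Longrightarrow> multilinear k (f s)"
  shows "multilinear k (\<lambda>as. \<Sum>s\<in>S. f s as)"
  unfolding multilinear_def
proof (intro allI impI)
  interpret pair: vector_space_pair scale scale ..
  fix as :: "'a list" and p
  assume "length as = k \<and> p < k"
  then show "Vector_Spaces.linear scale scale (\<lambda>x. \<Sum>s\<in>S. f s (as[p := x]))"
    using assms unfolding multilinear_def by (intro pair.linear_compose_sum) blast
qed

lemma has_degree_sum:
  assumes "\<And>s. s \<in> S \<Longrightarrow> has_degree k (f s) e"
  shows "has_degree k (\<lambda>as. \<Sum>s\<in>S. f s as) e"
  using assms unfolding has_degree_def by (blast intro: subspace_sum[OF subspace_component])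

end

text \<open>The labels before the block of length \<open>i\<close> at position \<open>l\<close>, those in the block, and those
  after it. The last group is indexed by its image under \<open>R0\<close>.\<close>

lemma sum_split_block:
  fixes g :: "nat \<Rightarrow> 'b::comm_monoid_add"
  assumes "1 \<le> i" "1 \<le> l" "l \<le> j"
  shows "(\<Sum>r = 1..i + j - 1. g r) =
    (\<Sum>t = 1..<l. g t) + (\<Sum>s = 1..i. g (s + (l - 1))) + (\<Sum>t = Suc l..j. g (t + (i - 1)))"
proof -
  have split: "{1..i + j - 1} =
      {1..<l} \<union> ({1 + (l - 1)..i + (l - 1)} \<union> {Suc l + (i - 1)..j + (i - 1)})"
    using assms by auto
  have "(\<Sum>r = 1..i + j - 1. g r) = (\<Sum>r = 1..<l. g r)
      + ((\<Sum>r = 1 + (l - 1)..i + (l - 1). g r) + (\<Sum>r = Suc l + (i - 1)..j + (i - 1). g r))"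
    using assms unfolding split
    by (subst sum.union_disjoint, simp, simp, force, subst sum.union_disjoint) auto
  then show ?thesis
    by (simp only: sum.shift_bounds_cl_nat_ivl add.assoc)
qed

context Dend_inf_algebra
begin

text \<open>The composite of the total operations at position \<open>l\<close> is the sum over all labels of the
  composites occurring in the \<open>Dend\<^sub>\<infinity>\<close> identity.\<close>

lemma sum_insert_op_R0_R:
  assumes i: "1 \<le> i" and l: "1 \<le> l" "l \<le> j" and len: "length as = i + j - 1"
  shows "(\<Sum>r = 1..i + j - 1. insert_op i l (\<mu> j (R0 j i l r)) (lin_ext (\<mu> i) (R j i l r)) as)
    = insert_op i l (\<lambda>bs. \<Sum>t = 1..j. \<mu> j t bs) (\<lambda>bs. \<Sum>s = 1..i. \<mu> i s bs) as"
proof -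
  define g where "g r = insert_op i l (\<mu> j (R0 j i l r)) (lin_ext (\<mu> i) (R j i l r)) as" for r
  define h where "h t = insert_op i l (\<mu> j t) (\<lambda>bs. \<Sum>s = 1..i. \<mu> i s bs) as" for t
  have outside: "lin_ext (\<mu> i) (R j i l r) = (\<lambda>bs. \<Sum>s = 1..i. \<mu> i s bs)"
    if "r < l \<or> l + i \<le> r" for r
    using that i by (auto simp: R_def C_def lin_ext_sum_single fun_eq_iff)
  have before: "g t = h t" if "t \<in> {1..<l}" for t
  proof -
    have "R0 j i l t = t"
      using that by (auto simp: R0_def)
    then show ?thesis
      using that by (simp add: g_def h_def outside)
  qed
  have after: "g (t + (i - 1)) = h t" if "t \<in> {Suc l..j}" for t
  proof -
    have "R0 j i l (t + (i - 1)) = t"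
      using that i l by (auto simp: R0_def)
    moreover have "lin_ext (\<mu> i) (R j i l (t + (i - 1))) = (\<lambda>bs. \<Sum>s = 1..i. \<mu> i s bs)"
      using that i by (intro outside) auto
    ultimately show ?thesis
      by (simp add: g_def h_def)
  qed
  have "g (s + (l - 1)) = insert_op i l (\<mu> j l) (\<mu> i s) as" if "s \<in> {1..i}" for s
  proof -
    have "lin_ext (\<mu> i) (R j i l (s + (l - 1))) = \<mu> i s"
      using that l by (auto simp: R_def lin_ext_single fun_eq_iff)
    moreover have "R0 j i l (s + (l - 1)) = l"
      using that l by (auto simp: R0_def)
    ultimately show ?thesis
      by (simp add: g_def)
  qed
  then have "(\<Sum>s = 1..i. g (s + (l - 1))) = (\<Sum>s = 1..i. insert_op i l (\<mu> j l) (\<mu> i s) as)"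
    by (rule sum.cong[OF refl])
  also have "\<dots> = h l"
    unfolding h_def
    by (rule multilinear_insert_op_sum[symmetric])
      (use i l len in \<open>auto intro!: multilinear simp: C_def\<close>)
  finally have block: "(\<Sum>s = 1..i. g (s + (l - 1))) = h l" .
  have "(\<Sum>r = 1..i + j - 1. g r) = (\<Sum>t = 1..<l. h t) + h l + (\<Sum>t = Suc l..j. h t)"
    by (simp only: sum_split_block[OF i l] block before after cong: sum.cong)
  \<comment> \<open>The same splitting, for a block of length 1.\<close>
  also have "\<dots> = (\<Sum>t = 1..j. h t)"
    using sum_split_block[of 1 l j h] l by simp
  finally show ?thesis
    by (simp add: g_def h_def insert_op_def)
qed

end

theorem theorem4p8:
  fixes scale :: "'k::field_char_0 \<Rightarrow> 'a::ab_group_add \<Rightarrow> 'a"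
    and A :: "int \<Rightarrow> 'a set"
    and \<mu> :: "nat \<Rightarrow> nat \<Rightarrow> 'a list \<Rightarrow> 'a"
  assumes "Dend_inf_algebra scale A \<mu>"
  shows "A_inf_algebra scale A (\<lambda>k as. \<Sum>r = 1..k. \<mu> k r as)"
proof -
  interpret Dend_inf_algebra scale A \<mu> by fact
  show ?thesis
  proof
    fix k :: nat
    assume k: "1 \<le> k"
    show "multilinear k (\<lambda>as. \<Sum>r = 1..k. \<mu> k r as)"
      using k by (intro multilinear_sum multilinear) (auto simp: C_def)
    show "has_degree k (\<lambda>as. \<Sum>r = 1..k. \<mu> k r as) (int k - 2)"
      using k by (intro has_degree_sum degree) (auto simp: C_def)
  next
    fix n :: nat and as :: "'a list" and ds :: "int list"
    assume n: "1 \<le> n" and len: "length as = n" and hom: "homogeneous ds as"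
    let ?IJ = "{(i, j). 1 \<le> i \<and> 1 \<le> j \<and> i + j = n + 1}"
    let ?term = "\<lambda>r i j l. insert_op i l (\<mu> j (R0 j i l r)) (lin_ext (\<mu> i) (R j i l r)) as"
    have "(\<Sum>(i, j)\<in>?IJ. \<Sum>l = 1..j. scale (sign i l ds)
          (insert_op i l (\<lambda>as. \<Sum>r = 1..j. \<mu> j r as) (\<lambda>as. \<Sum>r = 1..i. \<mu> i r as) as))
        = (\<Sum>(i, j)\<in>?IJ. \<Sum>l = 1..j. \<Sum>r = 1..n. scale (sign i l ds) (?term r i j l))"
    proof (intro sum.cong refl, clarify, intro sum.cong refl)
      fix i j l :: nat
      assume "1 \<le> i" "1 \<le> j" "i + j = n + 1" "l \<in> {1..j}"
      moreover from this have "n = i + j - 1"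
        by simp
      ultimately show "scale (sign i l ds)
          (insert_op i l (\<lambda>as. \<Sum>r = 1..j. \<mu> j r as) (\<lambda>as. \<Sum>r = 1..i. \<mu> i r as) as)
        = (\<Sum>r = 1..n. scale (sign i l ds) (?term r i j l))"
        using len
        by (simp add: sum_insert_op_R0_R[unfolded One_nat_def] scale_sum_right[symmetric])
    qed
    also have "\<dots> = (\<Sum>(i, j)\<in>?IJ. \<Sum>r = 1..n. \<Sum>l = 1..j. scale (sign i l ds) (?term r i j l))"
      by (intro sum.cong refl, clarify, rule sum.swap)
    also have "\<dots> = (\<Sum>r = 1..n. \<Sum>(i, j)\<in>?IJ. \<Sum>l = 1..j. scale (sign i l ds) (?term r i j l))"
      unfolding case_prod_unfold by (rule sum.swap)
    also have "\<dots> = 0"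
      using n len hom by (intro sum.neutral ballI dend_identity) (auto simp: C_def)
    finally show "(\<Sum>(i, j)\<in>?IJ. \<Sum>l = 1..j. scale (sign i l ds)
        (insert_op i l (\<lambda>as. \<Sum>r = 1..j. \<mu> j r as) (\<lambda>as. \<Sum>r = 1..i. \<mu> i r as) as)) = 0" .
  qed
qed

end
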